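(* For all integers $n,k\ge 1$, $$N_{n+k-1}(x)=\frac{1}{n!\,k!}\sum_{\pi\in\mathfrak{S}_n,\ \sigma\in\mathfrak{S}_k}B_\pi(x)\,B_\sigma(x)\,E_{\ell_\pi,\ell_\sigma}(x).$$
   Context: $\mathfrak{S}_n$ is the symmetric group on $\{1,\ldots,n\}$; permutations are written in one-line notation $w=w_1\cdots w_n$, and $\operatorname{des}(w)=|\{i:w_i>w_{i+1}\}|$. The Narayana polynomial is $N_n(x)=\sum_{k=0}^{n-1}\frac1n\binom nk\binom n{k+1}x^k$. For $m,n\ge1$, $E_{m,n}(x)=\sum x^{\operatorname{des}(w)}$, where the sum is over all $w\in\mathfrak{S}_{m+n}$ with $w_1\le m$ and $w_{m+n}\ge m+1$. The type B Narayana polynomial is $B_n(x)=\sum_{k=0}^{n-1}\binom{n-1}{k}^2x^k$. For a permutation $w$ with cycle type $(\lambda_1,\ldots,\lambda_\ell)$ (fixed points counted as cycles), $\ell_w=\ell$ is the number of cycles of $w$ and $B_w(x)=B_{\lambda_1}(x)\cdots B_{\lambda_\ell}(x)$. *)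

theory Defs
  imports
    "HOL-Computational_Algebra.Polynomial"
    "HOL-Combinatorics.Combinatorics"
    "HOL-Combinatorics.Orbits"
    "HOL-Library.Multiset"
begin

text \<open>
  Elements of the symmetric group on \<open>{1..n}\<close> are functions \<open>w :: nat \<Rightarrow> nat\<close> with
  \<open>w permutes {1..n}\<close> (identity outside \<open>{1..n}\<close>); the letter \<open>w\<^sub>i\<close> of the one-line
  notation is \<open>w i\<close>. All polynomial identities live in \<open>rat poly\<close>.
\<close>

definition sym_group :: "nat \<Rightarrow> (nat \<Rightarrow> nat) set" where
  "sym_group n = {w. w permutes {1..n}}"

definition des :: "nat \<Rightarrow> (nat \<Rightarrow> nat) \<Rightarrow> nat" where
  "des n w = card {i \<in> {1..<n}. w i > w (i + 1)}"

definition narayana_poly :: "nat \<Rightarrow> rat poly" where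
  "narayana_poly n =
     (\<Sum>k<n. monom (1 / of_nat n * of_nat (n choose k) * of_nat (n choose (k + 1))) k)"

text \<open>The two arguments of \<open>E\<close> and of \<open>B\<close> below are only meaningful when positive.\<close>

definition eulerian_E_poly :: "nat \<Rightarrow> nat \<Rightarrow> rat poly" where
  "eulerian_E_poly m n =
     (\<Sum>w \<in> {w \<in> sym_group (m + n). w 1 \<le> m \<and> w (m + n) \<ge> m + 1}. monom 1 (des (m + n) w))"

definition narayana_B_poly :: "nat \<Rightarrow> rat poly" where
  "narayana_B_poly n = (\<Sum>k<n. monom (of_nat (((n - 1) choose k) ^ 2)) k)"

text \<open>
  The supports of the cycles are the orbits of the points of \<open>{1..n}\<close>; a fixed point \<open>i\<close>
  contributes the orbit \<open>{i}\<close>. The degree \<open>n\<close> has to be passed explicitly because the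
  function alone does not determine how many fixed points belong to \<open>{1..n}\<close>.
\<close>

definition perm_cycles :: "nat \<Rightarrow> (nat \<Rightarrow> nat) \<Rightarrow> nat set set" where
  "perm_cycles n w = orbit w ` {1..n}"

definition cycle_type :: "nat \<Rightarrow> (nat \<Rightarrow> nat) \<Rightarrow> nat multiset" where
  "cycle_type n w = image_mset card (mset_set (perm_cycles n w))"

definition num_cycles :: "nat \<Rightarrow> (nat \<Rightarrow> nat) \<Rightarrow> nat" where
  "num_cycles n w = size (cycle_type n w)"

definition narayana_B_perm :: "nat \<Rightarrow> (nat \<Rightarrow> nat) \<Rightarrow> rat poly" where
  "narayana_B_perm n w = prod_mset (image_mset narayana_B_poly (cycle_type n w))"

end

theory Submission
  imports Defs "HOL-Computational_Algebra.Polynomial_FPS"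
begin

unbundle fps_syntax

text \<open>
  Sorting functions \<open>{1..m+n} \<rightarrow> {0..t}\<close> stably gives
  \<open>E\<^sub>m\<^sub>,\<^sub>n = (1 - x)\<^bsup>m+n-1\<^esup> \<Sum>\<^sub>t x\<^sup>t ((t + 1)\<^sup>m - t\<^sup>m)((t + 1)\<^sup>n - t\<^sup>n)\<close>.
  By the exponential formula, \<open>\<Sum>\<^sub>\<pi> B\<^sub>\<pi> ((1 - x) t)\<^bsup>\<ell>(\<pi>)\<^esup>\<close> over \<open>\<SS>\<^sub>n\<close> is \<open>n!\<close> times the coefficient of \<open>z\<^sup>n\<close> in
  \<open>\<phi>(z)\<^sup>t\<close> with \<open>\<phi> = exp ((1 - x) \<Sum>\<^sub>j B\<^sub>j z\<^sup>j / j)\<close>, and Lagrange inversion shows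
  \<open>\<phi> = (1 + a) / (1 + x a)\<close>, where \<open>a = \<Sum>\<^sub>n N\<^sub>n z\<^sup>n\<close> solves \<open>a = z (1 + a)(1 + x a)\<close>.
  With \<open>b = a(u)\<close>, the right-hand sides of the theorem thus have the bivariate generating function
  \<open>(\<phi>(z) - 1)(\<phi>(u) - 1) / ((1 - x)(1 - x \<phi>(z) \<phi>(u))) = a b / (1 - x a b)\<close>,
  and the equations for \<open>a\<close> and \<open>b\<close> turn this into \<open>z u (a - b) / (z - u) = \<Sum> N\<^bsub>n+k-1\<^esub> z\<^sup>n u\<^sup>k\<close>.
\<close>

subsection \<open>The Narayana series\<close>

text \<open>The recurrence is the coefficient form of \<open>a = z (1 + a)(1 + x a)\<close>. The
  parameter ranges over any commutative ring because it is finally taken to be \<open>fps_X\<close>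
  in \<open>rat fps\<close>, where the values become the Narayana polynomials.\<close>

fun nar_coeff :: "'a::comm_ring_1 \<Rightarrow> nat \<Rightarrow> 'a" where
  "nar_coeff x 0 = 0"
| "nar_coeff x (Suc n) = of_bool (n = 0) + (1 + x) * nar_coeff x n
     + x * (\<Sum>i\<le>n. nar_coeff x i * nar_coeff x (n - i))"

definition nar_fps :: "'a::comm_ring_1 \<Rightarrow> 'a fps" where
  "nar_fps x = Abs_fps (nar_coeff x)"

lemma nar_fps_nth_0 [simp]: "nar_fps x $ 0 = 0"
  by (simp add: nar_fps_def)

lemma nar_fps_eq:
  "nar_fps x = fps_X * ((1 + nar_fps x) * (1 + fps_const x * nar_fps x))"
proof (rule fps_ext)
  fix n
  let ?a = "nar_fps x"
  have *: "(1 + ?a) * (1 + fps_const x * ?a) = 1 + fps_const (1 + x) * ?a + fps_const x * (?a * ?a)"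
    by (simp add: algebra_simps flip: fps_const_add)
  show "?a $ n = (fps_X * ((1 + ?a) * (1 + fps_const x * ?a))) $ n"
    unfolding * by (cases n)
      (simp_all add: nar_fps_def fps_mult_nth[of "Abs_fps _" "Abs_fps _"] atMost_atLeast0)
qed

section \<open>Powers of a quadratic and Lagrange inversion\<close>

text \<open>The coefficient of \<open>y\<^sup>j\<close> in \<open>((1 + y)(1 + x y))\<^sup>n\<close>. The index \<open>j\<close> is an integer so that the
  recurrences below hold without side conditions.\<close>

definition trinomial :: "'a::comm_ring_1 \<Rightarrow> nat \<Rightarrow> int \<Rightarrow> 'a" where
  "trinomial x n j = (if j < 0 then 0 else coeff (([:1, 1:] * [:1, x:]) ^ n) (nat j))"

lemma trinomial_0: "trinomial x 0 j = of_bool (j = 0)"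
  by (auto simp: trinomial_def)

lemma coeff_mult_quadratic:
  fixes p :: "'a::comm_ring_1 poly"
  shows "coeff ([:a, b, c:] * p) n =
    a * coeff p n + (if n \<ge> 1 then b * coeff p (n - 1) else 0) + (if n \<ge> 2 then c * coeff p (n - 2) else 0)"
proof (cases n)
  case (Suc m)
  then show ?thesis by (cases m) (auto simp: algebra_simps)
qed simp

lemma trinomial_Suc:
  "trinomial x (Suc n) j =
     trinomial x n j + (1 + x) * trinomial x n (j - 1) + x * trinomial x n (j - 2)"
proof (cases "j < 0")
  case False
  have "[:1, 1:] * [:1, x:] = [:1, 1 + x, x:]" by simp
  with False show ?thesis
    unfolding trinomial_def power_Suc
    by (auto simp add: coeff_mult_quadratic nat_diff_distrib' simp del: mult_pCons_left
       intro!: arg_cong2[where f="(*)"] arg_cong2[where f=coeff])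
qed (simp add: trinomial_def)

text \<open>Compares the coefficients of \<open>y ^ (j - 1)\<close> in the derivative of
  \<open>t ^ Suc n\<close>, where \<open>t = (1 + y)(1 + x y)\<close> has derivative
  \<open>1 + x + 2 x y\<close>. For \<open>j \<le> 0\<close> both sides vanish.\<close>

lemma trinomial_absorb:
  fixes x :: "'a::idom"
  shows "of_int j * trinomial x (Suc n) j =
     of_nat (Suc n) * ((1 + x) * trinomial x n (j - 1) + 2 * x * trinomial x n (j - 2))"
proof (cases "j \<le> 0")
  case True
  then show ?thesis by (auto simp: trinomial_def)
next
  case False
  then obtain i where i: "j = int (Suc i)"
    by (metis not_le zero_less_imp_eq_int gr0_implies_Suc)
  let ?t = "[:1, 1:] * [:1, x:]"
  have "of_int j * trinomial x (Suc n) j = coeff (pderiv (?t ^ Suc n)) i"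
    by (simp add: trinomial_def i coeff_pderiv del: power_Suc mult_pCons_left of_nat_Suc)
  \<comment> \<open>The zero third coefficient makes the linear factor an instance of
    \<open>coeff_mult_quadratic\<close>.\<close>
  also have "pderiv (?t ^ Suc n) = smult (of_nat (Suc n)) ([:1 + x, 2 * x, 0:] * ?t ^ n)"
    by (simp add: pderiv_power_Suc pderiv_pCons algebra_simps del: power_Suc)
  also have "coeff \<dots> i =
      of_nat (Suc n) * ((1 + x) * trinomial x n (j - 1) + 2 * x * trinomial x n (j - 2))"
    unfolding coeff_smult coeff_mult_quadratic
    by (auto simp: i trinomial_def nat_diff_distrib' simp del: mult_pCons_left of_nat_Suc)
  finally show ?thesis .
qed

lemma coeff_linear_power:
  fixes x :: "'a::comm_ring_1"
  shows "coeff ([:1, x:] ^ n) i = of_nat (n choose i) * x ^ i"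
proof (cases "i \<le> n")
  case False
  then have "degree ([:1, x:] ^ n) < i"
    using degree_power_le[of "[:1, x:]" n] by (auto simp: not_le split: if_splits)
  then show ?thesis using False by (simp add: coeff_eq_0 binomial_eq_0)
qed (simp add: coeff_linear_poly_power)

text \<open>Cauchy product of \<open>(1 + x y) ^ n\<close> and \<open>(1 + y) ^ n\<close>. The cases
  \<open>m = n - 1\<close> and \<open>m = n\<close> yield the two kinds of Narayana
  polynomials.\<close>

lemma trinomial_eq_sum:
  "trinomial x n (int m) = (\<Sum>i\<le>m. of_nat (n choose (m - i)) * of_nat (n choose i) * x ^ i)"
proof -
  have "trinomial x n (int m) = coeff ([:1, x:] ^ n * [:1, 1:] ^ n) m"
    by (simp only: trinomial_def power_mult_distrib mult.commute) simp
  also have "\<dots> = (\<Sum>i\<le>m. of_nat (n choose (m - i)) * of_nat (n choose i) * x ^ i)"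
    unfolding coeff_mult by (intro sum.cong) (simp_all add: coeff_linear_power mult_ac)
  finally show ?thesis .
qed

text \<open>These are the middle coefficients of the powers of the quadratic. The series turns out
  to be \<open>z a' / a\<close>, and for \<open>x = fps_X\<close> its coefficient at
  \<open>n\<close> is the type B polynomial of index \<open>Suc n\<close>.\<close>

definition ctrinomial_fps :: "'a::comm_ring_1 \<Rightarrow> 'a fps" where
  "ctrinomial_fps x = Abs_fps (\<lambda>n. trinomial x n (int n))"

lemma ctrinomial_fps_nth [simp]: "ctrinomial_fps x $ n = trinomial x n (int n)"
  by (simp add: ctrinomial_fps_def)

text \<open>A form of Lagrange inversion. Replacing one factor \<open>a\<close> by
  \<open>z (1 + a)(1 + x a)\<close> lowers \<open>n\<close> and produces exactly the recurrence
  \<open>trinomial_Suc\<close>, so induction on \<open>n\<close> for all \<open>k\<close>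
  suffices.\<close>

lemma ctrinomial_mult_nar_power_nth:
  "(ctrinomial_fps x * nar_fps x ^ k) $ n = trinomial x n (int n - int k)"
proof (induction n arbitrary: k)
  case 0
  show ?case
    by (cases k) (auto simp: trinomial_0 fps_mult_nth_0 fps_power_zeroth)
next
  case (Suc n)
  let ?a = "nar_fps x" and ?D = "ctrinomial_fps x"
  show ?case
  proof (cases k)
    case 0
    then show ?thesis by simp
  next
    case (Suc k')
    have "?D * ?a ^ k = ?D * ?a ^ k' * ?a"
      by (simp add: Suc mult_ac)
    also have "\<dots> = ?D * ?a ^ k' * (fps_X * ((1 + ?a) * (1 + fps_const x * ?a)))"
      by (subst nar_fps_eq) (rule refl)
    also have "\<dots> = fps_X * (?D * ?a ^ k' + fps_const (1 + x) * (?D * ?a ^ k)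
        + fps_const x * (?D * ?a ^ Suc k))"
      by (simp add: Suc algebra_simps flip: fps_const_add)
    finally have "(?D * ?a ^ k) $ Suc n = (fps_X * (?D * ?a ^ k' + fps_const (1 + x) * (?D * ?a ^ k)
        + fps_const x * (?D * ?a ^ Suc k))) $ Suc n"
      by (rule arg_cong)
    also have "\<dots> = (?D * ?a ^ k') $ n + (1 + x) * (?D * ?a ^ k) $ n + x * (?D * ?a ^ Suc k) $ n"
      unfolding fps_X_mult_nth fps_add_nth fps_mult_left_const_nth by simp
    finally show ?thesis
      unfolding Suc.IH trinomial_Suc by (simp add: Suc algebra_simps)
  qed
qed

text \<open>Differentiating \<open>a = z t(a)\<close> gives \<open>W a' = t(a)\<close> with
  \<open>W = 1 - z t'(a)\<close>, and the series of middle coefficients is the inverse of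
  \<open>W\<close>.\<close>

lemma fps_X_mult_deriv_nar:
  fixes x :: "'a::{idom, semiring_char_0}"
  shows "fps_X * fps_deriv (nar_fps x) = ctrinomial_fps x * nar_fps x"
proof -
  let ?a = "nar_fps x" and ?D = "ctrinomial_fps x"
  define W where "W = 1 - fps_X * (fps_const (1 + x) + 2 * fps_const x * ?a)"
  have DW: "?D * W = 1"
  proof (rule fps_ext)
    fix n
    have *: "?D * W = ?D - fps_X * (fps_const (1 + x) * (?D * ?a ^ 0) + fps_const (2 * x) * (?D * ?a ^ 1))"
      by (simp add: W_def algebra_simps numeral_fps_const flip: fps_const_mult)
    show "(?D * W) $ n = 1 $ n"
    proof (cases n)
      case 0
      then show ?thesis by (simp add: trinomial_0 W_def)
    next
      case (Suc m)
      \<comment> \<open>At \<open>j = Suc m\<close> the absorption identity has the factor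
        \<open>Suc m\<close> on both sides, and characteristic 0 lets it cancel.\<close>
      have "of_nat (Suc m) * trinomial x (Suc m) (int (Suc m)) =
            of_nat (Suc m) * ((1 + x) * trinomial x m (int m) + 2 * x * trinomial x m (int m - 1))"
        using trinomial_absorb[of "int (Suc m)" x m] by simp
      then have "trinomial x (Suc m) (int (Suc m)) =
            (1 + x) * trinomial x m (int m) + 2 * x * trinomial x m (int m - 1)"
        by (simp only: mult_cancel_left of_nat_eq_0_iff) simp
      then show ?thesis
        unfolding * fps_sub_nth Suc fps_X_mult_nth
        using ctrinomial_mult_nar_power_nth[of x 1 m] by simp
    qed
  qed
  have "fps_deriv ?a = fps_deriv (fps_X * ((1 + ?a) * (1 + fps_const x * ?a)))"
    by (subst nar_fps_eq) (rule refl)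
  also have "\<dots> = (1 + ?a) * (1 + fps_const x * ?a)
      + fps_X * (fps_const (1 + x) + 2 * fps_const x * ?a) * fps_deriv ?a"
    by (simp add: algebra_simps flip: fps_const_add)
  finally have "fps_deriv ?a - fps_X * (fps_const (1 + x) + 2 * fps_const x * ?a) * fps_deriv ?a
      = (1 + ?a) * (1 + fps_const x * ?a)"
    by (simp only: diff_eq_eq)
  then have "W * fps_deriv ?a = (1 + ?a) * (1 + fps_const x * ?a)"
    by (simp only: W_def left_diff_distrib mult_1_left)
  \<comment> \<open>Multiplying by \<open>fps_X\<close> turns \<open>t(a)\<close> back into
    \<open>a\<close>.\<close>
  then have "fps_X * (W * fps_deriv ?a) = ?a"
    by (simp flip: nar_fps_eq)
  then have "?D * (fps_X * (W * fps_deriv ?a)) = ?D * ?a" by simp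
  moreover have "?D * (fps_X * (W * fps_deriv ?a)) = (?D * W) * (fps_X * fps_deriv ?a)"
    by (simp only: mult_ac)
  ultimately show ?thesis by (simp add: DW)
qed

lemma of_nat_mult_nar_coeff:
  fixes x :: "'a::{idom, semiring_char_0}"
  shows "of_nat n * nar_coeff x n = trinomial x n (int n - 1)"
proof -
  have "of_nat n * nar_coeff x n = (fps_X * fps_deriv (nar_fps x)) $ n"
    by (cases n) (simp_all add: nar_fps_def)
  also have "\<dots> = trinomial x n (int n - 1)"
    using ctrinomial_mult_nar_power_nth[of x 1 n] by (simp add: fps_X_mult_deriv_nar)
  finally show ?thesis .
qed

section \<open>Both kinds of Narayana polynomials as coefficients\<close>

lemma fps_of_poly_narayana_poly:
  assumes "n \<ge> 1"
  shows "fps_of_poly (narayana_poly n) = nar_coeff fps_X n"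
proof -
  have "of_nat n * fps_of_poly (narayana_poly n) = trinomial fps_X n (int (n - 1))"
  proof -
    have "{..n - 1} = {..<n}" using assms by auto
    moreover have "of_nat (n choose (n - 1 - i)) * of_nat (n choose i) * fps_X ^ i =
      (of_nat n * fps_of_poly (monom (1 / of_nat n * of_nat (n choose i) * of_nat (n choose (i + 1))) i) :: rat fps)"
      if "i < n" for i
    proof -
      have "n choose (n - 1 - i) = n choose (i + 1)"
        using that binomial_symmetric[of "i+1" n] by simp
      moreover have "(of_nat n :: rat) \<noteq> 0" using assms by simp
      ultimately show ?thesis
        by (simp add: fps_of_poly_monom fps_of_nat[symmetric] mult_ac)
    qed
    ultimately show ?thesis
      unfolding narayana_poly_def trinomial_eq_sum fps_of_poly_sum sum_distrib_left
      by (intro sum.cong) auto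
  qed
  also have "\<dots> = of_nat n * nar_coeff fps_X n"
    using assms of_nat_mult_nar_coeff[of n "fps_X :: rat fps"] by (simp add: of_nat_diff)
  finally show ?thesis using assms by simp
qed

lemma fps_of_poly_narayana_B_poly:
  "fps_of_poly (narayana_B_poly (Suc n)) = trinomial fps_X n (int n)"
  unfolding narayana_B_poly_def trinomial_eq_sum fps_of_poly_sum lessThan_Suc_atMost
proof (intro sum.cong refl)
  fix i assume "i \<in> {..n}"
  then have "n choose (n - i) = n choose i"
    using binomial_symmetric[of i n] by simp
  then show "fps_of_poly (monom (of_nat (((Suc n - 1) choose i) ^ 2)) i) =
      (of_nat (n choose (n - i)) * of_nat (n choose i) * fps_X ^ i :: rat fps)"
    by (simp add: fps_of_poly_monom fps_of_nat[symmetric] power2_eq_square flip: fps_const_mult)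
qed

section \<open>The logarithmic derivative of the ratio\<close>

text \<open>The quotient \<open>(1 + a) / (1 + x a)\<close> for \<open>a = nar_fps x\<close>; the denominator has constant term 1.\<close>

definition nar_ratio :: "'a::comm_ring_1 \<Rightarrow> 'a fps" where
  "nar_ratio x = (1 + nar_fps x) * fps_right_inverse (1 + fps_const x * nar_fps x) 1"

lemma nar_ratio_mult: "nar_ratio x * (1 + fps_const x * nar_fps x) = 1 + nar_fps x"
proof -
  have "(1 + fps_const x * nar_fps x) * fps_right_inverse (1 + fps_const x * nar_fps x) 1 = 1"
    by (rule fps_right_inverse) simp
  then show ?thesis
    unfolding nar_ratio_def by (metis mult.assoc mult.commute mult_1_right)
qed

lemma nar_ratio_nth_0 [simp]: "nar_ratio x $ 0 = 1"
  using arg_cong[OF nar_ratio_mult[of x], of "\<lambda>f. f $ 0"] by simp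

text \<open>This differential equation replaces the exponential: together with constant term 1 it
  says that the ratio is \<open>exp ((1 - x) \<Sum> B_j z^j / j)\<close> for
  \<open>x = fps_X\<close>.\<close>

lemma fps_deriv_nar_ratio:
  fixes x :: "'a::{idom, semiring_char_0}"
  shows "fps_deriv (nar_ratio x) = fps_const (1 - x) * ctrinomial_fps x * nar_ratio x"
proof -
  let ?a = "nar_fps x" and ?D = "ctrinomial_fps x" and ?r = "nar_ratio x"
  let ?w = "1 + fps_const x * ?a"
  \<comment> \<open>Cancelling \<open>fps_X\<close>, rather than dividing by \<open>a\<close>, gives
    a closed form for \<open>a'\<close>.\<close>
  have "fps_X * fps_deriv ?a = fps_X * (?D * ((1 + ?a) * ?w))"
    using fps_X_mult_deriv_nar[of x] nar_fps_eq[of x] by (metis mult.left_commute)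
  then have da: "fps_deriv ?a = ?D * ((1 + ?a) * ?w)"
    by (simp only: mult_cancel_left fps_X_neq_zero) simp
  have w0: "?w \<noteq> 0"
  proof
    assume "?w = 0"
    then have "?w $ 0 = 0" by (simp only: fps_zero_nth)
    then show False by simp
  qed
  have rw: "?r * ?w = 1 + ?a" by (rule nar_ratio_mult)
  have "fps_deriv (?r * ?w) = fps_deriv (1 + ?a)" by (simp only: rw)
  then have "fps_deriv ?r * ?w = fps_deriv ?a * (1 - fps_const x * ?r)"
    by (simp add: algebra_simps)
  \<comment> \<open>The second factor \<open>?w\<close> turns \<open>?r\<close> into
    \<open>1 + a\<close>, after which the bracket collapses to the constant
    \<open>1 - x\<close>.\<close>
  then have "fps_deriv ?r * ?w * ?w = fps_deriv ?a * (1 - fps_const x * ?r) * ?w"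
    by (rule arg_cong)
  also have "\<dots> = fps_deriv ?a * (?w - fps_const x * (?r * ?w))"
    by (simp add: algebra_simps)
  also have "?w - fps_const x * (?r * ?w) = fps_const (1 - x)"
    unfolding rw by (simp add: algebra_simps flip: fps_const_sub)
  also have "fps_deriv ?a * fps_const (1 - x) = fps_const (1 - x) * ?D * ?r * ?w * ?w"
    unfolding da rw[symmetric] by (simp only: mult_ac)
  finally show ?thesis using w0 by (simp only: mult_cancel_right) simp
qed

lemma fps_deriv_nar_ratio_power:
  fixes x :: "'a::{idom, semiring_char_0}"
  shows "fps_deriv (nar_ratio x ^ t) = fps_const (of_nat t * (1 - x)) * ctrinomial_fps x * nar_ratio x ^ t"
proof (induction t)
  case (Suc t)
  have *: "fps_const (of_nat (Suc t) * (1 - x)) = fps_const (of_nat t * (1 - x)) + fps_const (1 - x)"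
    by (simp add: algebra_simps)
  show ?case
    unfolding * power_Suc fps_deriv_mult Suc fps_deriv_nar_ratio by (simp only: algebra_simps)
qed simp

text \<open>Coefficient form of the differential equation, in the shape that the exponential formula
  for \<open>cycle_sum\<close> requires.\<close>

lemma nar_ratio_power_rec:
  fixes x :: "'a::{idom, semiring_char_0}"
  shows "of_nat (Suc n) * (nar_ratio x ^ t) $ Suc n =
    (\<Sum>j\<le>n. of_nat t * (1 - x) * trinomial x j (int j) * (nar_ratio x ^ t) $ (n - j))"
proof -
  have "of_nat (Suc n) * (nar_ratio x ^ t) $ Suc n = fps_deriv (nar_ratio x ^ t) $ n"
    by simp
  also have "\<dots> = (fps_const (of_nat t * (1 - x)) * (ctrinomial_fps x * nar_ratio x ^ t)) $ n"
    by (simp only: fps_deriv_nar_ratio_power mult.assoc)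
  finally show ?thesis
    unfolding fps_mult_left_const_nth fps_mult_nth[of "ctrinomial_fps x"]
    by (simp add: atMost_atLeast0 sum_distrib_left mult_ac)
qed

subsection \<open>Sums over permutations by cycle type\<close>

lemma orbit_eq_orbit:
  assumes "p permutes S" "finite S" "c \<in> orbit p b"
  shows "orbit p c = orbit p b"
  using orbit_cyclic_eq3[OF cyclic_on_orbit[OF assms(1,2)] assms(3)] .

lemma self_in_orbit:
  assumes "p permutes S" "finite S"
  shows "c \<in> orbit p c"
  using assms permutation_permutes permutation_self_in_orbit by metis

section \<open>Inserting a new point into a cycle\<close>

context
  fixes q :: "'a \<Rightarrow> 'a" and S a b
  assumes q: "q permutes S" and fin: "finite S" and a: "a \<notin> S" and b: "b \<in> S"
begin

text \<open>Since \<open>q\<close> fixes \<open>a\<close>, the new permutation sends the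
  \<open>q\<close>-preimage of \<open>b\<close> to \<open>a\<close> and \<open>a\<close> to
  \<open>b\<close>: the point \<open>a\<close> is placed immediately before \<open>b\<close> in its
  cycle.\<close>

abbreviation (input) "ins \<equiv> transpose a b \<circ> q"

lemma ins_permutes: "ins permutes insert a S"
  using q b by (intro permutes_compose permutes_swap_id) (auto intro: permutes_subset)

lemma orbit_ins_a: "orbit ins a = insert a (orbit q b)"
proof
  have qa: "q a = a" using q a by (rule permutes_not_in)
  have sub: "orbit q b \<subseteq> S" using permutes_orbit_subset[OF q b] .
  show "orbit ins a \<subseteq> insert a (orbit q b)"
  proof
    fix y assume "y \<in> orbit ins a"
    then show "y \<in> insert a (orbit q b)"
    proof induction
      case base
      then show ?case using self_in_orbit[OF q fin] by (simp add: qa)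
    next
      case (step y)
      then show ?case
        using self_in_orbit[OF q fin, of b] orbit.step[of y q b]
        by (auto simp: qa transpose_def)
    qed
  qed
  have a_in: "a \<in> orbit ins a" using self_in_orbit[OF ins_permutes] fin by simp
  have b_in: "b \<in> orbit ins a" using orbit.base[of ins a] by (simp add: qa)
  have "y \<in> orbit ins a" if "y \<in> orbit q b" for y
    using that
  proof induction
    case base
    show ?case
    proof (cases "q b = b")
      case False
      moreover have "q b \<noteq> a" using sub orbit.base[of q b] a by auto
      ultimately show ?thesis using orbit.step[OF b_in] by (simp add: comp_def)
    qed (use b_in in \<open>simp add: comp_def\<close>)
  next
    case (step y)
    show ?case
    \<comment> \<open>The transposition redirects \<open>q y\<close> only if it equals
      \<open>b\<close>, and \<open>b\<close> is already known to lie in the orbit.\<close>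
    proof (cases "q y = b")
      case False
      moreover have "q y \<noteq> a" using sub orbit.step[OF step.hyps] a by auto
      ultimately show ?thesis using orbit.step[OF step.IH] by (simp add: comp_def)
    qed (use b_in in \<open>simp add: comp_def\<close>)
  qed
  then show "insert a (orbit q b) \<subseteq> orbit ins a" using a_in by blast
qed

text \<open>Both permutations agree on the orbit of \<open>c\<close>, because \<open>q s = b\<close>
  would put \<open>b\<close> into that orbit.\<close>

lemma orbit_ins_other:
  assumes "c \<in> S" "c \<notin> orbit q b"
  shows "orbit ins c = orbit q c"
proof (rule orbit_cong)
  show "c \<in> orbit q c" by (rule self_in_orbit[OF q fin])
  fix s assume "s \<in> orbit q c"
  then have qs: "q s \<in> orbit q c" by (rule orbit.step)
  have "q s \<noteq> a" using qs permutes_orbit_subset[OF q assms(1)] a by auto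
  moreover have "q s \<noteq> b"
  proof
    assume "q s = b"
    then have "orbit q b = orbit q c" using orbit_eq_orbit[OF q fin] qs by simp
    then show False using assms(2) self_in_orbit[OF q fin] by auto
  qed
  ultimately show "ins s = q s" by simp
qed

lemma orbits_ins:
  "orbit ins ` insert a S - {orbit ins a} = orbit q ` S - {orbit q b}"
proof (intro equalityI subsetI)
  fix X assume "X \<in> orbit ins ` insert a S - {orbit ins a}"
  then obtain c where c: "c \<in> insert a S" "X = orbit ins c" "orbit ins c \<noteq> orbit ins a" by auto
  then have "c \<notin> insert a (orbit q b)"
    using orbit_eq_orbit[OF ins_permutes, of c a] fin by (auto simp: orbit_ins_a)
  with c have "c \<in> S" "X = orbit q c" "orbit q c \<noteq> orbit q b"
    using orbit_ins_other[of c] self_in_orbit[OF q fin, of c] by auto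
  then show "X \<in> orbit q ` S - {orbit q b}" by auto
next
  fix X assume "X \<in> orbit q ` S - {orbit q b}"
  then obtain c where c: "c \<in> S" "X = orbit q c" "orbit q c \<noteq> orbit q b" by auto
  then have "c \<notin> orbit q b" using orbit_eq_orbit[OF q fin] by auto
  with c have "orbit ins c = orbit q c" by (intro orbit_ins_other)
  moreover have "a \<notin> orbit q c" using permutes_orbit_subset[OF q c(1)] a by auto
  ultimately show "X \<in> orbit ins ` insert a S - {orbit ins a}" using c orbit_ins_a by auto
qed

lemma card_orbit_ins: "card (orbit ins a) = Suc (card (orbit q b))"
proof -
  have "orbit q b \<subseteq> S" using permutes_orbit_subset[OF q b] .
  then show ?thesis unfolding orbit_ins_a using a fin by (subst card_insert_disjoint) (auto dest: finite_subset)
qed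

end

section \<open>The exponential formula\<close>

text \<open>The cycle through the marked point \<open>a\<close> gets its own weight \<open>h\<close>, so that inserting a new
  point next to \<open>a\<close> amounts to shifting \<open>h\<close>.\<close>

definition pointed_cycle_sum ::
  "(nat \<Rightarrow> 'b) \<Rightarrow> (nat \<Rightarrow> 'b) \<Rightarrow> 'a set \<Rightarrow> 'a \<Rightarrow> 'b::comm_ring_1" where
  "pointed_cycle_sum g h A a = (\<Sum>p | p permutes A. h (card (orbit p a)) *
      (\<Prod>X \<in> orbit p ` A - {orbit p a}. g (card X)))"

definition cycle_sum :: "(nat \<Rightarrow> 'b) \<Rightarrow> 'a set \<Rightarrow> 'b::comm_ring_1" where
  "cycle_sum g A = (\<Sum>p | p permutes A. \<Prod>X \<in> orbit p ` A. g (card X))"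

lemma cycle_sum_eq_pointed:
  assumes "finite A" "a \<in> A"
  shows "cycle_sum g A = pointed_cycle_sum g g A a"
  unfolding cycle_sum_def pointed_cycle_sum_def
  using assms by (intro sum.cong refl prod.remove) auto

text \<open>Every permutation of \<open>insert a S\<close> is uniquely
  \<open>transpose a b \<circ> q\<close> with \<open>q\<close> permuting \<open>S\<close>. For
  \<open>b = a\<close> the point \<open>a\<close> is fixed; for \<open>b \<in> S\<close> it makes
  the cycle of \<open>b\<close> longer by one.\<close>

lemma pointed_cycle_sum_insert:
  assumes "finite S" "a \<notin> S"
  shows "pointed_cycle_sum g h (insert a S) a =
    h 1 * cycle_sum g S + (\<Sum>b\<in>S. pointed_cycle_sum g (h \<circ> Suc) S b)"
proof -
  let ?f = "\<lambda>p. h (card (orbit p a)) * (\<Prod>X \<in> orbit p ` insert a S - {orbit p a}. g (card X))"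
  have 1: "?f q = h 1 * (\<Prod>X \<in> orbit q ` S. g (card X))" if "q permutes S" for q
  proof -
    have o: "orbit q a = {a}"
      using permutes_not_in[OF that assms(2)] orbit_eq_singleton_iff by metis
    moreover have "orbit q ` insert a S - {{a}} = orbit q ` S"
      using permutes_orbit_subset[OF that] assms(2) o by fastforce
    ultimately show ?thesis by simp
  qed
  have 2: "?f (transpose a b \<circ> q) = (h \<circ> Suc) (card (orbit q b)) *
      (\<Prod>X \<in> orbit q ` S - {orbit q b}. g (card X))" if "q permutes S" "b \<in> S" for q b
    using orbits_ins[OF that(1) assms that(2)] card_orbit_ins[OF that(1) assms that(2)] by simp
  have "pointed_cycle_sum g h (insert a S) a =
      (\<Sum>q | q permutes S. ?f q) + (\<Sum>b\<in>S. \<Sum>q | q permutes S. ?f (transpose a b \<circ> q))"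
    unfolding pointed_cycle_sum_def sum_over_permutations_insert[OF assms]
    using assms by (subst sum.insert) simp_all
  also have "(\<Sum>q | q permutes S. ?f q) = h 1 * cycle_sum g S"
    unfolding cycle_sum_def sum_distrib_left using 1 by (intro sum.cong) auto
  also have "(\<Sum>b\<in>S. \<Sum>q | q permutes S. ?f (transpose a b \<circ> q)) =
      (\<Sum>b\<in>S. pointed_cycle_sum g (h \<circ> Suc) S b)"
    unfolding pointed_cycle_sum_def using 2 by (intro sum.cong) auto
  finally show ?thesis .
qed

text \<open>The exponential formula: \<open>rec\<close> is the coefficient form of
  \<open>z P' = P \<Sum> g(j) z^j\<close>, that is, of
  \<open>P = exp (\<Sum> g(j) z^j / j)\<close>.\<close>

lemma cycle_sum_eq_fact_mult:
  fixes g p :: "nat \<Rightarrow> 'b::{comm_ring_1, semiring_char_0}" and A :: "'a set"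
  assumes p0: "p 0 = 1"
    and rec: "\<And>n. of_nat (Suc n) * p (Suc n) = (\<Sum>j\<le>n. g (Suc j) * p (n - j))"
    and "finite A"
  shows "cycle_sum g A = fact (card A) * p (card A)"
  using assms(3)
proof (induction "card A" arbitrary: A rule: less_induct)
  case less
  \<comment> \<open>The inner induction keeps \<open>h\<close> general because removing the marked
    point shifts it. The last premise carries the outer induction hypothesis for smaller
    sets.\<close>
  have pointed: "pointed_cycle_sum g h A a = fact n * (\<Sum>j\<le>n. h (Suc j) * p (n - j))"
    if "finite A" "a \<in> A" "card A = Suc n" 
      "\<And>B :: 'a set. finite B \<Longrightarrow> card B < card A \<Longrightarrow> cycle_sum g B = fact (card B) * p (card B)"
    for h n and A :: "'a set" and a
    using that
  proof (induction n arbitrary: A a h)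
    case 0
    then have "A = insert a {}" by (auto simp: card_Suc_eq)
    then show ?case
      using pointed_cycle_sum_insert[of "{}" a g h] 0 by (simp add: cycle_sum_def p0)
  next
    case (Suc n)
    define S where "S = A - {a}"
    have S: "A = insert a S" "a \<notin> S" "finite S" "card S = Suc n" using Suc.prems by (auto simp: S_def)
    have "pointed_cycle_sum g h A a = h 1 * cycle_sum g S + (\<Sum>b\<in>S. pointed_cycle_sum g (h \<circ> Suc) S b)"
      unfolding S(1) using S by (intro pointed_cycle_sum_insert)
    also have "cycle_sum g S = fact (Suc n) * p (Suc n)"
      using Suc.prems(4)[of S] S by simp
    also have "(\<Sum>b\<in>S. pointed_cycle_sum g (h \<circ> Suc) S b) =
        (\<Sum>b\<in>S. fact n * (\<Sum>j\<le>n. (h \<circ> Suc) (Suc j) * p (n - j)))"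
      using S Suc.prems(3,4) by (intro sum.cong refl Suc.IH) auto
    \<comment> \<open>The \<open>Suc n\<close> choices of \<open>b\<close> turn
      \<open>fact n\<close> into \<open>fact (Suc n)\<close>; the term with \<open>h 1\<close> is
      then the missing summand \<open>j = 0\<close>.\<close>
    also have "\<dots> = fact (Suc n) * (\<Sum>j\<le>n. h (Suc (Suc j)) * p (n - j))"
      using S by (simp add: mult_ac)
    finally show ?case
      by (simp add: sum.atMost_Suc_shift algebra_simps del: sum.atMost_Suc)
  qed
  show ?case
  proof (cases "A = {}")
    case True
    then show ?thesis by (simp add: cycle_sum_def p0)
  next
    case False
    then obtain a where a: "a \<in> A" by auto
    then obtain n where n: "card A = Suc n"
      using less.prems by (metis card_Suc_Diff1)
    have "cycle_sum g A = fact n * (\<Sum>j\<le>n. g (Suc j) * p (n - j))"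
      unfolding cycle_sum_eq_pointed[OF less.prems a]
      by (rule pointed[OF less.prems a n]) (use less.hyps in auto)
    also have "\<dots> = fact (Suc n) * p (Suc n)"
      by (simp flip: rec add: algebra_simps)
    finally show ?thesis by (simp add: n)
  qed
qed

text \<open>Distributes one factor \<open>y\<close> to each cycle, which makes the summand a product
  of cycle weights.\<close>

lemma narayana_B_perm_mult_power:
  fixes y :: "rat fps"
  shows "fps_of_poly (narayana_B_perm n w) * y ^ num_cycles n w =
    (\<Prod>X \<in> orbit w ` {1..n}. y * fps_of_poly (narayana_B_poly (card X)))"
proof -
  have "narayana_B_perm n w = (\<Prod>X \<in> perm_cycles n w. narayana_B_poly (card X))"
    by (simp add: narayana_B_perm_def cycle_type_def prod_unfold_prod_mset image_mset.compositionality comp_def)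
  moreover have "num_cycles n w = card (perm_cycles n w)"
    by (simp add: num_cycles_def cycle_type_def)
  ultimately show ?thesis
    by (simp add: fps_of_poly_prod prod.distrib perm_cycles_def mult.commute)
qed

subsection \<open>The refined Eulerian polynomials\<close>

text \<open>The permutation that sorts \<open>f\<close> stably, i.e. that sorts the pairs \<open>(f j, j)\<close> lexicographically:
  the sorted values may stay constant across an ascent of \<open>w\<close> but must increase across a descent.\<close>

lemma ex1_sorting_permutation:
  fixes f :: "nat \<Rightarrow> nat"
  shows "\<exists>!w. w permutes {1..N} \<and> (\<forall>i\<in>{1..<N}. f (w i) + of_bool (w i > w (i + 1)) \<le> f (w (i + 1)))"
    (is "\<exists>!w. ?P w")
proof -
  define lt where "lt j k \<longleftrightarrow> f j < f k \<or> f j = f k \<and> j < k" for j k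
  have lt_trans: "lt i k" if "lt i j" "lt j k" for i j k using that by (auto simp: lt_def)
  have lt_irrefl: "\<not> lt i i" for i by (auto simp: lt_def)
  have lt_total: "lt j k \<or> j = k \<or> lt k j" for j k by (auto simp: lt_def)
  \<comment> \<open>Initial segments of the order \<open>lt\<close>: \<open>r j\<close> is the rank
    of \<open>j\<close>, counted from 1, and the sorting permutation is the inverse of
    \<open>r\<close>.\<close>
  define L where "L j = {k \<in> {1..N}. k = j \<or> lt k j}" for j
  define r where "r j = (if j \<in> {1..N} then card (L j) else j)" for j
  have finL: "finite (L j)" for j by (simp add: L_def)
  have P_iff: "?P w \<longleftrightarrow> w permutes {1..N} \<and> (\<forall>i\<in>{1..<N}. lt (w i) (w (i + 1)))" for w
  proof -
    have "f (w i) + of_bool (w i > w (i + 1)) \<le> f (w (i + 1)) \<longleftrightarrow> lt (w i) (w (i + 1))"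
      if "w permutes {1..N}" for i
    proof -
      have "w i \<noteq> w (i + 1)" using permutes_inj[OF that] by (simp add: inj_eq)
      then show ?thesis by (cases "w i > w (i + 1)") (auto simp: lt_def)
    qed
    then show ?thesis by blast
  qed
  have r_mono: "r j < r k" if "j \<in> {1..N}" "k \<in> {1..N}" "lt j k" for j k
  proof -
    have "L j \<subseteq> L k" using that(3) lt_trans[of _ j k] unfolding L_def by blast
    moreover have "k \<in> L k" "k \<notin> L j"
      using that lt_irrefl[of j] lt_trans[of j k j] unfolding L_def by auto
    ultimately have "L j \<subset> L k" by blast
    then show ?thesis using that psubset_card_mono[OF finL] by (simp add: r_def)
  qed
  have r_inj: "inj_on r {1..N}"
  proof (rule inj_onI)
    fix j k assume "j \<in> {1..N}" "k \<in> {1..N}" "r j = r k"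
    then show "j = k" using r_mono[of j k] r_mono[of k j] lt_total[of j k] by auto
  qed
  have r_in: "r j \<in> {1..N}" if "j \<in> {1..N}" for j
  proof -
    have "j \<in> L j" using that by (simp add: L_def)
    then have "card (L j) > 0" using finL card_gt_0_iff by blast
    moreover have "card (L j) \<le> card {1..N}" by (rule card_mono) (auto simp: L_def)
    ultimately show ?thesis using that by (simp add: r_def)
  qed
  have r_perm: "r permutes {1..N}"
  proof (rule bij_imp_permutes)
    show "bij_betw r {1..N} {1..N}"
      using r_inj r_in by (simp add: bij_betw_def endo_inj_surj image_subset_iff)
  qed (auto simp: r_def)
  have "?P (inv r)"
    unfolding P_iff
  proof (intro conjI ballI permutes_inv r_perm)
    fix i assume i: "i \<in> {1..<N}"
    have in_r: "inv r i \<in> {1..N}" "inv r (i + 1) \<in> {1..N}"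
      using i permutes_in_image[OF permutes_inv[OF r_perm]] by auto
    have rr: "r (inv r i) = i" for i using permutes_inverses(1)[OF r_perm] .
    show "lt (inv r i) (inv r (i + 1))"
    proof (rule ccontr)
      assume "\<not> lt (inv r i) (inv r (i + 1))"
      then have "inv r i = inv r (i + 1) \<or> lt (inv r (i + 1)) (inv r i)"
        using lt_total by blast
      then have "r (inv r (i + 1)) \<le> r (inv r i)"
        using r_mono[OF in_r(2,1)] by (auto dest: less_imp_le)
      then show False by (simp add: rr del: permutes_inverses)
    qed
  qed
  \<comment> \<open>A permutation increasing for \<open>lt\<close> at each step is increasing
    throughout, so the segment below \<open>w i\<close> is \<open>w\<close> applied to
    \<open>{1..i}\<close> and \<open>w i\<close> has rank \<open>i\<close>.\<close>
  moreover have "w = inv r" if "?P w" for w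
  proof -
    from that have w: "w permutes {1..N}" and step: "\<And>i. i \<in> {1..<N} \<Longrightarrow> lt (w i) (w (i + 1))"
      unfolding P_iff by auto
    have less: "lt (w i) (w j)" if "1 \<le> i" "i < j" "j \<le> N" for i j
      using that(2,3)
    proof (induction j)
      case (Suc j)
      then show ?case using step[of j] that(1) lt_trans by (cases "i = j") auto
    qed auto
    have "r (w i) = i" for i
    proof (cases "i \<in> {1..N}")
      case True
      have "L (w i) = w ` {1..i}"
      proof (intro equalityI subsetI)
        fix k assume "k \<in> L (w i)"
        then have k: "k \<in> {1..N}" "k = w i \<or> lt k (w i)" by (auto simp: L_def)
        then obtain j where j: "j \<in> {1..N}" "k = w j"
          using permutes_image[OF w] by blast
        have "\<not> i < j"
        proof
          assume "i < j"
          then have "lt (w i) k" using less[of i j] j True by auto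
          then show False using k(2) lt_trans[of "w i" k "w i"] lt_irrefl[of "w i"] by auto
        qed
        then have "j \<le> i" by simp
        then show "k \<in> w ` {1..i}" using j by auto
      next
        fix k assume "k \<in> w ` {1..i}"
        then obtain j where j: "1 \<le> j" "j \<le> i" "k = w j" by auto
        then have "w j \<in> {1..N}" using permutes_in_image[OF w] True by auto
        then show "k \<in> L (w i)" using less[of j i] j True by (auto simp: L_def le_less)
      qed
      then have "card (L (w i)) = i"
        using card_image[of w "{1..i}"] permutes_inj_on[OF w] by simp
      then show ?thesis using True permutes_in_image[OF w] by (simp add: r_def)
    next
      case False
      then show ?thesis using permutes_not_in[OF w False] by (auto simp: r_def)
    qed
    then have "r \<circ> w = id" by (simp add: fun_eq_iff)
    then have "inv r \<circ> (r \<circ> w) = inv r" by simp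
    then show ?thesis by (simp add: comp_assoc[symmetric] permutes_inv_o[OF r_perm])
  qed
  ultimately show ?thesis by blast
qed

section \<open>Counting sorted sequences with prescribed minimal steps\<close>

definition stair :: "(nat \<Rightarrow> nat) \<Rightarrow> nat \<Rightarrow> nat \<Rightarrow> (nat \<Rightarrow> nat) set" where
  "stair d N t = {g \<in> extensional {1..N}. g 1 = 0 \<and> g N = t \<and> (\<forall>i\<in>{1..<N}. g i + d i \<le> g (i + 1))}"

lemma stair_1: "stair d 1 t = (if t = 0 then {(\<lambda>i. undefined)(1 := 0)} else {})"
  by (auto simp: stair_def extensional_def fun_eq_iff)

lemma stair_Suc:
  assumes "N \<ge> 1"
  shows "stair d (Suc N) t = (\<lambda>g. g(Suc N := t)) ` (\<Union>s \<in> {s. s + d N \<le> t}. stair d N s)"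
proof (intro equalityI subsetI)
  fix g assume g: "g \<in> stair d (Suc N) t"
  let ?g = "g(Suc N := undefined)"
  have "?g \<in> stair d N (g N)" "g N + d N \<le> t"
    using g assms unfolding stair_def extensional_def mem_Collect_eq by auto
  moreover have "g = ?g(Suc N := t)" using g by (auto simp: stair_def)
  ultimately show "g \<in> (\<lambda>g. g(Suc N := t)) ` (\<Union>s \<in> {s. s + d N \<le> t}. stair d N s)" by blast
next
  fix g assume "g \<in> (\<lambda>g. g(Suc N := t)) ` (\<Union>s \<in> {s. s + d N \<le> t}. stair d N s)"
  then obtain h s where "s + d N \<le> t" "h \<in> stair d N s" "g = h(Suc N := t)" by auto
  then show "g \<in> stair d (Suc N) t"
    using assms unfolding stair_def extensional_def mem_Collect_eq
    by (auto simp: less_Suc_eq)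
qed

lemma finite_stair: "N \<ge> 1 \<Longrightarrow> finite (stair d N t)"
proof (induction N arbitrary: t rule: dec_induct)
  case base
  show ?case using stair_1[of d t] by simp
next
  case (step N)
  have "finite {s. s + d N \<le> t}" by (rule finite_subset[of _ "{..t}"]) auto
  then show ?case using step by (simp add: stair_Suc)
qed

lemma card_stair_Suc:
  assumes "N \<ge> 1"
  shows "card (stair d (Suc N) t) = (\<Sum>s | s + d N \<le> t. card (stair d N s))"
proof -
  have "inj_on (\<lambda>g. g(Suc N := t)) (\<Union>s \<in> {s. s + d N \<le> t}. stair d N s)"
  proof (rule inj_onI)
    fix g h
    assume "g \<in> (\<Union>s \<in> {s. s + d N \<le> t}. stair d N s)" "h \<in> (\<Union>s \<in> {s. s + d N \<le> t}. stair d N s)"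
      and eq: "g(Suc N := t) = h(Suc N := t)"
    then have "g (Suc N) = h (Suc N)" by (auto simp: stair_def extensional_def)
    with eq show "g = h" by (metis fun_upd_triv fun_upd_upd)
  qed
  then have "card (stair d (Suc N) t) = card (\<Union>s \<in> {s. s + d N \<le> t}. stair d N s)"
    unfolding stair_Suc[OF assms] by (rule card_image)
  also have "\<dots> = (\<Sum>s | s + d N \<le> t. card (stair d N s))"
  proof (rule card_UN_disjoint)
    show "finite {s. s + d N \<le> t}" by (rule finite_subset[of _ "{..t}"]) auto
    show "\<forall>s\<in>{s. s + d N \<le> t}. finite (stair d N s)" using assms by (simp add: finite_stair)
  qed (auto simp: stair_def)
  finally show ?thesis .
qed

text \<open>Each step from \<open>i\<close> to \<open>i + 1\<close> is an arbitrary increment of at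
  least \<open>d i\<close> and contributes \<open>x^(d i) / (1 - x)\<close>; the denominators are
  cleared.\<close>

lemma card_stair_fps:
  assumes "N \<ge> 1"
  shows "Abs_fps (\<lambda>t. of_nat (card (stair d N t))) * (1 - fps_X) ^ (N - 1) =
    (fps_X ^ (\<Sum>i\<in>{1..<N}. d i) :: 'a::comm_ring_1 fps)"
  using assms
proof (induction N rule: dec_induct)
  case base
  show ?case
    by (rule fps_ext) (simp add: stair_1[simplified])
next
  case (step N)
  let ?G = "\<lambda>N. Abs_fps (\<lambda>t. of_nat (card (stair d N t))) :: 'a fps"
  have "?G (Suc N) * (1 - fps_X) = ?G N * fps_X ^ d N"
  proof (rule fps_ext)
    fix t
    have fin: "finite {s. s + d N \<le> t}" for t by (rule finite_subset[of _ "{..t}"]) auto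
    show "(?G (Suc N) * (1 - fps_X)) $ t = (?G N * fps_X ^ d N) $ t"
    proof (cases t)
      case 0
      have "{s. s + d N \<le> 0} = (if d N = 0 then {0} else {})" by auto
      then show ?thesis
        using 0 by (simp add: card_stair_Suc[OF step.hyps(1)] fps_X_power_mult_right_nth algebra_simps)
    next
      case (Suc u)
      \<comment> \<open>Raising the bound by one adds at most the single value
        \<open>Suc u - d N\<close>, so only its term survives multiplication by
        \<open>1 - fps_X\<close>.\<close>
      have "{s. s + d N \<le> Suc u} =
          (if d N \<le> Suc u then insert (Suc u - d N) {s. s + d N \<le> u} else {s. s + d N \<le> u})" by auto
      then show ?thesis
        using Suc fin[of u]
        by (auto simp: card_stair_Suc[OF step.hyps(1)] fps_X_power_mult_right_nth right_diff_distrib)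
    qed
  qed
  moreover have "(1 - fps_X) ^ (Suc N - 1) = (1 - fps_X :: 'a fps) * (1 - fps_X) ^ (N - 1)"
    using step.hyps by (cases N) auto
  ultimately have "?G (Suc N) * (1 - fps_X) ^ (Suc N - 1) = (?G N * fps_X ^ d N) * (1 - fps_X) ^ (N - 1)"
    by (metis mult.assoc)
  also have "\<dots> = (?G N * (1 - fps_X) ^ (N - 1)) * fps_X ^ d N" by (simp only: mult_ac)
  also have "\<dots> = fps_X ^ (\<Sum>i\<in>{1..<Suc N}. d i)"
    using step.hyps by (simp only: step.IH power_add[symmetric] sum.atLeastLessThan_Suc)
  finally show ?case .
qed

section \<open>Functions attaining the extreme values on prescribed blocks\<close>

definition marked_fun :: "nat \<Rightarrow> nat \<Rightarrow> nat \<Rightarrow> (nat \<Rightarrow> nat) set" where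
  "marked_fun m n t = {f \<in> {1..m + n} \<rightarrow>\<^sub>E {..t}. 0 \<in> f ` {1..m} \<and> t \<in> f ` {m + 1..m + n}}"

lemma card_PiE_two_blocks:
  assumes "finite U" "finite V"
  shows "card (PiE {1..m + n} (\<lambda>i. if i \<le> m then U else V)) = card U ^ m * card V ^ n"
proof -
  have "{i \<in> {1..m + n}. i \<le> m} = {1..m}" "{i \<in> {1..m + n}. \<not> i \<le> m} = {m + 1..m + n}" by auto
  then show ?thesis
    by (simp add: card_PiE if_distrib[of card] prod.If_cases Int_def Collect_neg_eq[symmetric] conj_commute)
qed

text \<open>Inclusion-exclusion over the functions that avoid \<open>0\<close> on the first block or
  \<open>t\<close> on the second. The two blocks are restricted independently, so every count is a
  product.\<close>

lemma card_marked_fun: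
  "int (card (marked_fun m n t)) = ((int t + 1) ^ m - int t ^ m) * ((int t + 1) ^ n - int t ^ n)"
proof -
  define S where "S U V = PiE {1..m + n} (\<lambda>i. if i \<le> m then U else V)" for U V :: "nat set"
  let ?T = "{..t}" and ?A = "{..t} - {0}" and ?B = "{..t} - {t}"
  have fin: "finite (S U V)" if "finite U" "finite V" for U V
    unfolding S_def using that by (intro finite_PiE) auto
  have card_S: "int (card (S U V)) = int (card U) ^ m * int (card V) ^ n" if "finite U" "finite V" for U V
    using card_PiE_two_blocks[OF that] by (simp add: S_def)
  have mem_S: "f \<in> S U V \<longleftrightarrow> f \<in> extensional {1..m + n} \<and> f ` {1..m} \<subseteq> U \<and> f ` {m + 1..m + n} \<subseteq> V" for f U V
  proof -
    have "{1..m + n} = {1..m} \<union> {m + 1..m + n}" by auto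
    then show ?thesis unfolding S_def PiE_def Pi_def by (auto simp: image_subset_iff)
  qed
  have mem_A: "f \<in> S ?A V \<longleftrightarrow> f \<in> S ?T V \<and> 0 \<notin> f ` {1..m}" for f V
    unfolding mem_S by blast
  have mem_B: "f \<in> S U ?B \<longleftrightarrow> f \<in> S U ?T \<and> t \<notin> f ` {m + 1..m + n}" for f U
    unfolding mem_S by blast
  have "{1..m + n} \<rightarrow>\<^sub>E {..t} = S ?T ?T" by (simp add: S_def)
  then have "marked_fun m n t = S ?T ?T - (S ?A ?T \<union> S ?T ?B)"
    unfolding marked_fun_def using mem_A mem_B by blast
  moreover have sub: "S ?A ?T \<subseteq> S ?T ?T" "S ?T ?B \<subseteq> S ?T ?T" using mem_A mem_B by blast+
  moreover have "S ?A ?T \<inter> S ?T ?B = S ?A ?B" using mem_A mem_B by blast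
  moreover have "card (S ?A ?T) + card (S ?T ?B) = card (S ?A ?T \<union> S ?T ?B) + card (S ?A ?T \<inter> S ?T ?B)"
    by (intro card_Un_Int fin) auto
  moreover have "card (S ?A ?T \<union> S ?T ?B) \<le> card (S ?T ?T)"
    using sub by (intro card_mono fin) auto
  moreover have "card (S ?T ?T - (S ?A ?T \<union> S ?T ?B)) = card (S ?T ?T) - card (S ?A ?T \<union> S ?T ?B)"
    using sub by (intro card_Diff_subset finite_subset[OF _ fin]) auto
  ultimately have "int (card (marked_fun m n t)) =
      int (card (S ?T ?T)) - int (card (S ?A ?T)) - int (card (S ?T ?B)) + int (card (S ?A ?B))"
    by (simp add: of_nat_diff)
  also have "\<dots> = ((int t + 1) ^ m - int t ^ m) * ((int t + 1) ^ n - int t ^ n)"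
    by (simp add: card_S algebra_simps)
  finally show ?thesis .
qed

definition descent_ind :: "(nat \<Rightarrow> nat) \<Rightarrow> nat \<Rightarrow> nat" where
  "descent_ind w i = of_bool (w i > w (i + 1))"

lemma des_eq_sum: "des N w = (\<Sum>i\<in>{1..<N}. descent_ind w i)"
  by (simp add: des_def descent_ind_def Int_def conj_commute)

definition eulerian_perms :: "nat \<Rightarrow> nat \<Rightarrow> (nat \<Rightarrow> nat) set" where
  "eulerian_perms m n = {w \<in> sym_group (m + n). w 1 \<le> m \<and> w (m + n) \<ge> m + 1}"

lemma card_sorted_by:
  assumes "w permutes {1..N}"
  shows "card {f. f \<circ> w \<in> stair d N t} = card (stair d N t)"
proof (rule bij_betw_same_card)
  show "bij_betw (\<lambda>f. f \<circ> w) {f. f \<circ> w \<in> stair d N t} (stair d N t)"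
    by (rule bij_betwI[where g="\<lambda>g. g \<circ> inv w"])
      (use assms in \<open>auto simp: comp_assoc permutes_inv_o\<close>)
qed

text \<open>If \<open>0\<close> is attained on the first block and \<open>t\<close> on the second, stable sorting puts a point of the
  first block in front and a point of the second block at the end.\<close>

lemma marked_fun_eq_UN:
  assumes "m \<ge> 1" "n \<ge> 1"
  shows "marked_fun m n t =
    (\<Union>w \<in> eulerian_perms m n. {f. f \<circ> w \<in> stair (descent_ind w) (m + n) t})"
proof (intro equalityI subsetI)
  let ?N = "m + n"
  fix f assume f: "f \<in> marked_fun m n t"
  obtain w where w: "w permutes {1..?N}"
    and sorted: "\<And>i. i \<in> {1..<?N} \<Longrightarrow> f (w i) + descent_ind w i \<le> f (w (i + 1))"
    using ex1_sorting_permutation[of ?N f] unfolding descent_ind_def by blast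
  \<comment> \<open>Along \<open>w\<close> the pairs \<open>(f (w i), w i)\<close> increase
    lexicographically.\<close>
  have mono: "f (w i) < f (w j) \<or> f (w i) = f (w j) \<and> w i \<le> w j" if "1 \<le> i" "i \<le> j" "j \<le> ?N" for i j
    using that(2,3)
  proof (induction j)
    case (Suc j)
    show ?case
    proof (cases "i = Suc j")
      case False
      have "f (w j) < f (w (Suc j)) \<or> f (w j) = f (w (Suc j)) \<and> w j \<le> w (Suc j)"
        using sorted[of j] Suc.prems False \<open>1 \<le> i\<close>
        by (cases "w j > w (Suc j)") (auto simp: descent_ind_def)
      then show ?thesis using Suc False by auto
    qed simp
  qed simp
  have ex: "\<exists>i. 1 \<le> i \<and> i \<le> ?N \<and> j = w i" if "j \<in> {1..?N}" for j
  proof -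
    have "j \<in> w ` {1..?N}" using that permutes_image[OF w] by simp
    then show ?thesis by auto
  qed
  have in_w: "w i \<in> {1..?N} \<longleftrightarrow> i \<in> {1..?N}" for i using permutes_in_image[OF w] .
  from f obtain j k where j: "j \<in> {1..m}" "f j = 0" and k: "k \<in> {m + 1..?N}" "f k = t"
    unfolding marked_fun_def by (elim CollectE conjE imageE) metis
  from f have ext: "f \<in> extensional {1..?N}" and le: "\<And>i. i \<in> {1..?N} \<Longrightarrow> f i \<le> t"
    unfolding marked_fun_def PiE_def Pi_def by blast+
  obtain i where i: "1 \<le> i" "i \<le> ?N" "j = w i" using ex[of j] j by auto
  \<comment> \<open>The pair at position 1 is lexicographically at most \<open>(0, j)\<close> with
    \<open>j \<le> m\<close>; the last position is treated symmetrically.\<close>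
  have w1: "f (w 1) = 0" "w 1 \<le> m" using mono[of 1 i] i j by auto
  obtain i' where i': "1 \<le> i'" "i' \<le> ?N" "k = w i'" using ex[of k] k by auto
  have "f (w ?N) \<le> t" using le in_w[of ?N] assms by auto
  then have wN: "f (w ?N) = t" "w ?N \<ge> m + 1" using mono[of i' ?N] i' k by auto
  have "f \<circ> w \<in> extensional {1..?N}"
    using ext in_w unfolding extensional_def mem_Collect_eq comp_apply by blast
  then have "f \<circ> w \<in> stair (descent_ind w) ?N t"
    using w1 wN sorted by (auto simp: stair_def)
  then show "f \<in> (\<Union>w \<in> eulerian_perms m n. {f. f \<circ> w \<in> stair (descent_ind w) ?N t})"
    using w w1 wN by (auto simp: eulerian_perms_def sym_group_def)
next
  let ?N = "m + n"
  fix f assume "f \<in> (\<Union>w \<in> eulerian_perms m n. {f. f \<circ> w \<in> stair (descent_ind w) ?N t})"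
  then obtain w where w: "w permutes {1..?N}" "w 1 \<le> m" "w ?N \<ge> m + 1"
    and f: "f \<circ> w \<in> stair (descent_ind w) ?N t"
    by (auto simp: eulerian_perms_def sym_group_def)
  have in_w: "w i \<in> {1..?N} \<longleftrightarrow> i \<in> {1..?N}" for i using permutes_in_image[OF w(1)] .
  have inv_w: "w (inv w i) = i" "inv w i \<in> {1..?N} \<longleftrightarrow> i \<in> {1..?N}" for i
    using permutes_inverses(1)[OF w(1)] permutes_in_image[OF permutes_inv[OF w(1)]] by auto
  have f1: "f (w 1) = 0" and fN: "f (w ?N) = t" using f by (simp_all add: stair_def)
  have step: "f (w i) \<le> f (w (Suc i))" if "1 \<le> i" "i < ?N" for i
  proof -
    have "(f \<circ> w) i + descent_ind w i \<le> (f \<circ> w) (i + 1)"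
      using f that unfolding stair_def mem_Collect_eq by (meson atLeastLessThan_iff)
    then show ?thesis by simp
  qed
  have le: "f (w i) \<le> f (w ?N)" if "1 \<le> i" "i \<le> ?N" for i
    using that(2,1)
  proof (induction i rule: inc_induct)
    case (step i)
    then show ?case using \<open>\<And>i. \<lbrakk>1 \<le> i; i < ?N\<rbrakk> \<Longrightarrow> f (w i) \<le> f (w (Suc i))\<close>[of i] by linarith
  qed simp
  have "f i \<le> t" if "i \<in> {1..?N}" for i
    using le[of "inv w i"] that inv_w(1)[of i] inv_w(2)[of i] fN by auto
  moreover have "f \<in> extensional {1..?N}"
  proof (unfold extensional_def, safe)
    fix i assume "i \<notin> {1..?N}"
    then have "(f \<circ> w) (inv w i) = undefined"
      using f inv_w(2)[of i] unfolding stair_def extensional_def by blast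
    then show "f i = undefined" by (simp add: inv_w)
  qed
  moreover have "0 \<in> f ` {1..m}"
    using f1 w(2) in_w[of 1] assms by (intro image_eqI[of _ _ "w 1"]) auto
  moreover have "t \<in> f ` {m + 1..?N}"
    using fN w(3) in_w[of ?N] assms by (intro image_eqI[of _ _ "w ?N"]) auto
  ultimately show "f \<in> marked_fun m n t"
    unfolding marked_fun_def PiE_def Pi_def by simp
qed

text \<open>Uniqueness of the sorting permutation makes the union in \<open>marked_fun_eq_UN\<close>
  disjoint.\<close>

lemma sum_card_stair:
  assumes "m \<ge> 1" "n \<ge> 1"
  shows "(\<Sum>w \<in> eulerian_perms m n. card (stair (descent_ind w) (m + n) t)) = card (marked_fun m n t)"
proof -
  let ?F = "\<lambda>w. {f. f \<circ> w \<in> stair (descent_ind w) (m + n) t}"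
  have perm: "w permutes {1..m + n}" if "w \<in> eulerian_perms m n" for w
    using that by (simp add: eulerian_perms_def sym_group_def)
  have fin: "finite (eulerian_perms m n)"
    unfolding eulerian_perms_def sym_group_def by (rule finite_subset[OF _ finite_permutations[of "{1..m + n}"]]) auto
  have finF: "finite (?F w)" if "w \<in> eulerian_perms m n" for w
  proof (rule finite_subset)
    show "?F w \<subseteq> marked_fun m n t" using that unfolding marked_fun_eq_UN[OF assms] by blast
    show "finite (marked_fun m n t)"
      by (rule finite_subset[of _ "{1..m + n} \<rightarrow>\<^sub>E {..t}"]) (auto simp: marked_fun_def intro: finite_PiE)
  qed
  have "card (marked_fun m n t) = (\<Sum>w \<in> eulerian_perms m n. card (?F w))"
    unfolding marked_fun_eq_UN[OF assms]
  proof (rule card_UN_disjoint)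
    show "\<forall>w\<in>eulerian_perms m n. \<forall>v\<in>eulerian_perms m n. w \<noteq> v \<longrightarrow> ?F w \<inter> ?F v = {}"
    proof (intro ballI impI, rule ccontr)
      fix w v assume wv: "w \<in> eulerian_perms m n" "v \<in> eulerian_perms m n" "w \<noteq> v" "?F w \<inter> ?F v \<noteq> {}"
      then obtain f where "f \<in> ?F w" "f \<in> ?F v" by blast
      then have "\<forall>i\<in>{1..<m + n}. f (w i) + of_bool (w i > w (i + 1)) \<le> f (w (i + 1))"
        "\<forall>i\<in>{1..<m + n}. f (v i) + of_bool (v i > v (i + 1)) \<le> f (v (i + 1))"
        unfolding mem_Collect_eq stair_def descent_ind_def comp_apply by blast+
      with ex1_sorting_permutation[of "m + n" f] perm[OF wv(1)] perm[OF wv(2)] wv(3) show False by blast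
    qed
  qed (use fin finF in auto)
  also have "\<dots> = (\<Sum>w \<in> eulerian_perms m n. card (stair (descent_ind w) (m + n) t))"
    using perm by (intro sum.cong refl card_sorted_by)
  finally show ?thesis by simp
qed

text \<open>For each \<open>w\<close> the minimal steps add up to its number of descents, so
  \<open>fps_X ^ des (m + n) w\<close> is a cleared generating function of sorted sequences. Summed
  over \<open>w\<close>, these count the marked functions.\<close>

lemma fps_of_poly_eulerian_E_poly:
  assumes "m \<ge> 1" "n \<ge> 1"
  shows "fps_of_poly (eulerian_E_poly m n) = (1 - fps_X) ^ (m + n - 1) *
    Abs_fps (\<lambda>t. ((of_nat t + 1) ^ m - of_nat t ^ m) * ((of_nat t + 1) ^ n - of_nat t ^ n))"
proof -
  have "fps_of_poly (eulerian_E_poly m n) = (\<Sum>w \<in> eulerian_perms m n. fps_X ^ des (m + n) w)"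
    by (simp add: eulerian_E_poly_def eulerian_perms_def fps_of_poly_sum fps_of_poly_monom')
  also have "\<dots> = (\<Sum>w \<in> eulerian_perms m n. (1 - fps_X) ^ (m + n - 1) *
      Abs_fps (\<lambda>t. of_nat (card (stair (descent_ind w) (m + n) t))))"
  proof (intro sum.cong refl)
    fix w
    show "fps_X ^ des (m + n) w = (1 - fps_X) ^ (m + n - 1) *
        (Abs_fps (\<lambda>t. of_nat (card (stair (descent_ind w) (m + n) t))) :: rat fps)"
      using assms by (simp only: des_eq_sum card_stair_fps[of "m + n", symmetric] mult.commute)
  qed
  also have "\<dots> = (1 - fps_X) ^ (m + n - 1) *
      Abs_fps (\<lambda>t. of_nat (\<Sum>w \<in> eulerian_perms m n. card (stair (descent_ind w) (m + n) t)))"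
    unfolding sum_distrib_left[symmetric]
    by (intro arg_cong2[where f="(*)"] refl fps_ext) (simp add: fps_sum_nth)
  also have "(\<lambda>t. of_nat (\<Sum>w \<in> eulerian_perms m n. card (stair (descent_ind w) (m + n) t)) :: rat) =
      (\<lambda>t. ((of_nat t + 1) ^ m - of_nat t ^ m) * ((of_nat t + 1) ^ n - of_nat t ^ n))"
  proof
    fix t
    have "rat_of_int (int (card (marked_fun m n t))) =
        ((of_nat t + 1) ^ m - of_nat t ^ m) * ((of_nat t + 1) ^ n - of_nat t ^ n)"
      unfolding card_marked_fun by simp
    then show "rat_of_nat (\<Sum>w \<in> eulerian_perms m n. card (stair (descent_ind w) (m + n) t)) =
        ((of_nat t + 1) ^ m - of_nat t ^ m) * ((of_nat t + 1) ^ n - of_nat t ^ n)"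
      unfolding sum_card_stair[OF assms] by simp
  qed
  finally show ?thesis .
qed

subsection \<open>The bivariate generating function\<close>

text \<open>In \<open>'a fps fps\<close> the outer variable is \<open>u\<close> and the inner one is \<open>z\<close>. A series in \<open>z\<close> is embedded by
  \<open>fps_const\<close>, a series in \<open>u\<close> by \<open>fps_lift\<close>.\<close>

definition fps_lift :: "'a::comm_ring_1 fps \<Rightarrow> 'a fps fps" where
  "fps_lift f = Abs_fps (\<lambda>k. fps_const (f $ k))"

lemma fps_lift_nth [simp]: "fps_lift f $ k = fps_const (f $ k)"
  by (simp add: fps_lift_def)

lemma fps_lift_simps:
  "fps_lift 1 = 1" "fps_lift fps_X = fps_X" "fps_lift (fps_const c) = fps_const (fps_const c)"
  "fps_lift (f + g) = fps_lift f + fps_lift g" "fps_lift (f - g) = fps_lift f - fps_lift g"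
  by (auto intro!: fps_ext)

lemma fps_const_sum: "fps_const (sum f A) = (\<Sum>i\<in>A. fps_const (f i :: 'a::comm_ring_1))"
  by (rule fps_ext) (simp add: fps_sum_nth)

lemma fps_lift_mult: "fps_lift (f * g) = fps_lift f * fps_lift g"
  by (rule fps_ext) (simp add: fps_mult_nth fps_const_sum flip: fps_const_mult)

lemma fps_lift_power: "fps_lift (f ^ n) = fps_lift f ^ n"
  by (induction n) (simp_all add: fps_lift_simps fps_lift_mult)

text \<open>The divided difference \<open>z u (a(z) - a(u)) / (z - u)\<close>. The guard keeps the
  borders \<open>n = 0\<close> and \<open>k = 0\<close> empty.\<close>

definition nar_bivariate :: "'a::comm_ring_1 \<Rightarrow> 'a fps fps" where
  "nar_bivariate x = Abs_fps (\<lambda>k. Abs_fps (\<lambda>n. if n \<ge> 1 \<and> k \<ge> 1 then nar_coeff x (n + k - 1) else 0))"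

text \<open>The coefficients depend only on \<open>n + k\<close>, so multiplication by
  \<open>z - u\<close> cancels everything except the terms next to the borders.\<close>

lemma nar_bivariate_difference:
  fixes x :: "'a::comm_ring_1"
  defines "a \<equiv> fps_const (nar_fps x)" and "b \<equiv> fps_lift (nar_fps x)"
    and "z \<equiv> fps_const fps_X" and "u \<equiv> fps_X"
  shows "(z - u) * nar_bivariate x = z * u * (a - b)"
proof (rule fps_ext, rule fps_ext)
  fix k n
  have "z * u * (a - b) = fps_X * (fps_const fps_X * (a - b))"
    by (simp only: z_def u_def mult_ac)
  then have *: "(z * u * (a - b)) $ k $ n =
      (if k = 0 \<or> n = 0 then 0 else (a $ (k - 1) $ (n - 1) - b $ (k - 1) $ (n - 1)))"
    by (simp only:) simp
  show "((z - u) * nar_bivariate x) $ k $ n = (z * u * (a - b)) $ k $ n"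
    unfolding *
    unfolding a_def b_def z_def u_def left_diff_distrib
    by (cases k; cases n) (auto simp: nar_bivariate_def nar_fps_def not_le less_Suc_eq_0_disj)
qed

lemma nar_bivariate_eq:
  fixes x :: "'a::idom"
  defines "a \<equiv> fps_const (nar_fps x)" and "b \<equiv> fps_lift (nar_fps x)"
    and "y \<equiv> fps_const (fps_const x)"
  shows "nar_bivariate x * (1 - y * a * b) = a * b"
proof -
  define z u :: "'a fps fps" where "z = fps_const fps_X" and "u = fps_X"
  have a: "a = z * ((1 + a) * (1 + y * a))"
    unfolding a_def y_def z_def
    by (subst nar_fps_eq) (simp only: fps_const_mult[symmetric] fps_const_add[symmetric] fps_const_1_eq_1)
  have b: "b = u * ((1 + b) * (1 + y * b))"
    unfolding b_def y_def u_def
    by (subst nar_fps_eq) (simp only: fps_lift_simps fps_lift_mult)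
  have diff: "(z - u) * nar_bivariate x = z * u * (a - b)"
    unfolding a_def b_def z_def u_def by (rule nar_bivariate_difference)
  \<comment> \<open>The equation for \<open>b\<close> is inserted into \<open>z a b\<close> and the
    one for \<open>a\<close> into \<open>u a b\<close>; the difference then has the factor
    \<open>a - b\<close>.\<close>
  have "(z - u) * (a * b) = z * a * (u * ((1 + b) * (1 + y * b))) - u * b * (z * ((1 + a) * (1 + y * a)))"
    by (subst (1) a[symmetric], subst (1) b[symmetric]) (simp only: algebra_simps)
  also have "\<dots> = z * u * (a - b) * (1 - y * a * b)"
    by (simp add: algebra_simps)
  also have "\<dots> = (z - u) * (nar_bivariate x * (1 - y * a * b))"
    by (simp only: diff mult.assoc[symmetric])
  finally have "(z - u) * (a * b) = (z - u) * (nar_bivariate x * (1 - y * a * b))" .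
  moreover have "z - u \<noteq> 0"
  proof
    assume "z - u = 0"
    then have "(z - u) $ 1 = 0" by (simp only: fps_zero_nth)
    then show False by (simp add: z_def u_def)
  qed
  ultimately show ?thesis by (simp only: mult_cancel_left) simp
qed

text \<open>Multiplying by \<open>(1 + x a)(1 + x b)\<close> clears both ratios. Then
  \<open>1 - x p q\<close> becomes \<open>(1 - x)(1 - x a b)\<close>, while \<open>p - 1\<close> and
  \<open>q - 1\<close> become \<open>(1 - x) a\<close> and \<open>(1 - x) b\<close>.\<close>

lemma nar_bivariate_ratio:
  fixes x :: "'a::idom"
  defines "p \<equiv> fps_const (nar_ratio x)" and "q \<equiv> fps_lift (nar_ratio x)"
    and "y \<equiv> fps_const (fps_const x)"
  shows "(1 - y) * nar_bivariate x * (1 - y * p * q) = (p - 1) * (q - 1)"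
proof -
  define a b where "a = fps_const (nar_fps x)" and "b = fps_lift (nar_fps x)"
  let ?V = "nar_bivariate x"
  have V: "?V * (1 - y * a * b) = a * b"
    unfolding a_def b_def y_def by (rule nar_bivariate_eq)
  have p: "p * (1 + y * a) = 1 + a"
    unfolding p_def y_def a_def using arg_cong[OF nar_ratio_mult[of x], of fps_const]
    by (simp only: fps_const_mult[symmetric] fps_const_add[symmetric] fps_const_1_eq_1)
  have q: "q * (1 + y * b) = 1 + b"
    unfolding q_def y_def b_def using arg_cong[OF nar_ratio_mult[of x], of fps_lift]
    by (simp only: fps_lift_mult fps_lift_simps)
  have "(1 - y) * ?V * (1 - y * p * q) * ((1 + y * a) * (1 + y * b)) =
      (1 - y) * ?V * ((1 + y * a) * (1 + y * b) - y * (p * (1 + y * a)) * (q * (1 + y * b)))"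
    by (simp add: algebra_simps)
  also have "\<dots> = (1 - y) * (1 - y) * (?V * (1 - y * a * b))"
    unfolding p q by (simp add: algebra_simps)
  also have "\<dots> = (p * (1 + y * a) - (1 + y * a)) * (q * (1 + y * b) - (1 + y * b))"
    unfolding p q V by (simp add: algebra_simps)
  also have "\<dots> = (p - 1) * (q - 1) * ((1 + y * a) * (1 + y * b))"
    by (simp add: algebra_simps)
  finally have "(1 - y) * ?V * (1 - y * p * q) * ((1 + y * a) * (1 + y * b)) =
      (p - 1) * (q - 1) * ((1 + y * a) * (1 + y * b))" .
  moreover have "1 + y * a \<noteq> 0"
  proof
    assume "1 + y * a = 0"
    then have "(1 + y * a) $ 0 $ 0 = 0" by (simp only: fps_zero_nth)
    then show False by (simp add: y_def a_def)
  qed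
  moreover have "1 + y * b \<noteq> 0"
  proof
    assume "1 + y * b = 0"
    then have "(1 + y * b) $ 0 $ 0 = 0" by (simp only: fps_zero_nth)
    then show False by (simp add: y_def b_def)
  qed
  ultimately show ?thesis by (simp only: mult_cancel_right) simp
qed

definition nar_ratio_diff :: "'a::comm_ring_1 \<Rightarrow> nat \<Rightarrow> nat \<Rightarrow> 'a" where
  "nar_ratio_diff x t n = (nar_ratio x ^ Suc t) $ n - (nar_ratio x ^ t) $ n"

text \<open>The geometric series \<open>\<Sum>\<^sub>t (x \<phi>(z) \<phi>(u))\<^sup>t\<close> converges only \<open>x\<close>-adically, so all identities involving
  it are stated modulo \<open>x\<^sup>T\<close>.\<close>

lemma nar_coeff_truncated:
  fixes x :: "'a::idom"
  assumes "x \<noteq> 1" "n \<ge> 1" "k \<ge> 1"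
  shows "x ^ T dvd (1 - x) * nar_coeff x (n + k - 1) -
    (\<Sum>t<T. x ^ t * (nar_ratio_diff x t n * nar_ratio_diff x t k))"
proof -
  define p q y where "p = fps_const (nar_ratio x)" and "q = fps_lift (nar_ratio x)"
    and "y = fps_const (fps_const x)"
  let ?V = "nar_bivariate x"
  define w where "w = y * p * q"
  have eq: "(1 - y) * ?V * (1 - w) = (p - 1) * (q - 1)"
    unfolding w_def p_def q_def y_def by (rule nar_bivariate_ratio)
  \<comment> \<open>The constant coefficient of \<open>1 - w\<close> is \<open>1 - x\<close>, as
    both ratios have constant term 1.\<close>
  have w: "1 - w \<noteq> 0"
  proof
    assume "1 - w = 0"
    then have "(1 - w) $ 0 $ 0 = 0" by (simp only: fps_zero_nth)
    then show False using assms(1) by (simp add: w_def y_def p_def q_def)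
  qed
  have "(1 - w) * ((\<Sum>t<T. w ^ t) * ((p - 1) * (q - 1))) = (1 - w ^ T) * ((p - 1) * (q - 1))"
    by (simp only: mult.assoc[symmetric] one_diff_power_eq)
  also have "\<dots> = (1 - w) * ((1 - w ^ T) * ((1 - y) * ?V))"
    by (simp only: eq[symmetric] mult_ac)
  finally have geometric: "(\<Sum>t<T. w ^ t) * ((p - 1) * (q - 1)) = (1 - w ^ T) * ((1 - y) * ?V)"
    using w by (simp only: mult_cancel_left) simp
  \<comment> \<open>The remainder of the geometric sum carries \<open>w ^ T\<close> and hence
    \<open>y ^ T\<close>, which gives the divisibility coefficientwise.\<close>
  have "(1 - y) * ?V - (\<Sum>t<T. w ^ t * ((p - 1) * (q - 1))) = y ^ T * ((p * q) ^ T * ((1 - y) * ?V))"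
    unfolding sum_distrib_right[symmetric] geometric
    by (simp add: w_def power_mult_distrib left_diff_distrib right_diff_distrib mult_ac)
  then have *: "((1 - y) * ?V) $ k $ n - (\<Sum>t<T. w ^ t * ((p - 1) * (q - 1))) $ k $ n =
      (y ^ T * ((p * q) ^ T * ((1 - y) * ?V))) $ k $ n"
    by (metis fps_sub_nth)
  have "(w ^ t * ((p - 1) * (q - 1))) $ k $ n = x ^ t * (nar_ratio_diff x t n * nar_ratio_diff x t k)" for t
  proof -
    let ?r = "nar_ratio x"
    have "w ^ t * ((p - 1) * (q - 1)) = y ^ t * (p ^ t * (p - 1) * (q ^ t * (q - 1)))"
      by (simp only: w_def power_mult_distrib mult_ac)
    also have "\<dots> = fps_const (fps_const (x ^ t)) *
        (fps_const (?r ^ Suc t - ?r ^ t) * fps_lift (?r ^ Suc t - ?r ^ t))"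
      unfolding y_def p_def q_def
      by (simp add: fps_const_power fps_lift_power fps_lift_mult fps_lift_simps algebra_simps
          flip: fps_const_mult fps_const_sub)
    finally show ?thesis
      by (simp add: nar_ratio_diff_def)
  qed
  then have "(\<Sum>t<T. w ^ t * ((p - 1) * (q - 1))) $ k $ n =
      (\<Sum>t<T. x ^ t * (nar_ratio_diff x t n * nar_ratio_diff x t k))"
    by (simp add: fps_sum_nth)
  moreover have "((1 - y) * ?V) $ k $ n = (1 - x) * nar_coeff x (n + k - 1)"
  proof -
    have "1 - y = fps_const (fps_const (1 - x))"
      by (simp add: y_def flip: fps_const_sub)
    then show ?thesis using assms by (simp add: nar_bivariate_def)
  qed
  moreover have "y ^ T = fps_const (fps_const (x ^ T))" by (simp add: y_def fps_const_power)
  ultimately show ?thesis using * by simp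
qed

section \<open>Both sides of the theorem modulo powers of \<open>fps_X\<close>\<close>

lemma fps_X_power_dvd_truncation:
  fixes f :: "'a::comm_ring_1 fps"
  shows "fps_X ^ T dvd f - (\<Sum>t<T. fps_X ^ t * fps_const (f $ t))"
proof -
  have "f - (\<Sum>t<T. fps_X ^ t * fps_const (f $ t)) = fps_X ^ T * fps_shift T f"
  proof (rule fps_ext)
    fix i
    have "(\<Sum>t<T. (fps_X ^ t * fps_const (f $ t)) $ i) = (\<Sum>t<T. if t = i then f $ i else 0)"
      by (intro sum.cong) auto
    then show "(f - (\<Sum>t<T. fps_X ^ t * fps_const (f $ t))) $ i = (fps_X ^ T * fps_shift T f) $ i"
      by (auto simp: fps_sum_nth fps_X_power_mult_nth)
  qed
  then show ?thesis by simp
qed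

text \<open>The powers of \<open>1 - x\<close> in \<open>(1 - x) E\<close> are split as
  \<open>m + n\<close>, so that each summand in \<open>t\<close> becomes a product with one factor
  for each of the two permutations.\<close>

definition eulerian_factor :: "nat \<Rightarrow> nat \<Rightarrow> rat fps" where
  "eulerian_factor t l = (1 - fps_X) ^ l * (of_nat (Suc t) ^ l - of_nat t ^ l)"

lemma eulerian_E_poly_truncated:
  assumes "m \<ge> 1" "n \<ge> 1"
  shows "fps_X ^ T dvd (1 - fps_X) * fps_of_poly (eulerian_E_poly m n) -
    (\<Sum>t<T. fps_X ^ t * (eulerian_factor t m * eulerian_factor t n))"
proof -
  define G :: "rat fps" where "G = Abs_fps (\<lambda>t. ((of_nat t + 1) ^ m - of_nat t ^ m) * ((of_nat t + 1) ^ n - of_nat t ^ n))"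
  have "(1 - fps_X) * (1 - fps_X :: rat fps) ^ (m + n - 1) = (1 - fps_X) ^ m * (1 - fps_X) ^ n"
    using assms by (simp flip: power_Suc power_add)
  then have 1: "(1 - fps_X) * fps_of_poly (eulerian_E_poly m n) = (1 - fps_X) ^ m * (1 - fps_X) ^ n * G"
    unfolding fps_of_poly_eulerian_E_poly[OF assms] G_def by (simp only: mult.assoc[symmetric])
  have c: "fps_const (G $ t) = (of_nat (Suc t) ^ m - of_nat t ^ m) * (of_nat (Suc t) ^ n - of_nat t ^ n)" for t
  proof -
    have "of_nat t + 1 = (of_nat (Suc t) :: rat)" by simp
    then show ?thesis
      unfolding G_def fps_nth_Abs_fps by (simp only:) (simp add: fps_of_nat[symmetric] del: of_nat_Suc)
  qed
  have 2: "(\<Sum>t<T. fps_X ^ t * (eulerian_factor t m * eulerian_factor t n)) =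
      (1 - fps_X) ^ m * (1 - fps_X) ^ n * (\<Sum>t<T. fps_X ^ t * fps_const (G $ t))"
    unfolding c sum_distrib_left eulerian_factor_def by (intro sum.cong refl) (simp only: mult_ac)
  show ?thesis
    unfolding 1 2 right_diff_distrib[symmetric] by (intro dvd_mult fps_X_power_dvd_truncation)
qed

text \<open>The exponential formula with weight \<open>(1 - x) t B_j\<close> for a cycle of length
  \<open>j\<close>.\<close>

lemma sum_narayana_B_perm_power:
  "(\<Sum>w \<in> sym_group n. fps_of_poly (narayana_B_perm n w) * ((1 - fps_X) * of_nat t) ^ num_cycles n w) =
    fact n * (nar_ratio fps_X ^ t) $ n"
proof -
  let ?g = "\<lambda>j. (1 - fps_X) * of_nat t * fps_of_poly (narayana_B_poly j)"
  have "cycle_sum ?g {1..n} = fact (card {1..n}) * (nar_ratio fps_X ^ t) $ card {1..n}"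
  proof (rule cycle_sum_eq_fact_mult)
    fix n
    show "of_nat (Suc n) * (nar_ratio fps_X ^ t) $ Suc n =
        (\<Sum>j\<le>n. ?g (Suc j) * (nar_ratio fps_X ^ t :: rat fps fps) $ (n - j))"
      unfolding nar_ratio_power_rec fps_of_poly_narayana_B_poly
      by (intro sum.cong refl) (simp only: mult_ac)
  qed (simp_all add: fps_power_zeroth)
  then show ?thesis
    by (simp add: cycle_sum_def sym_group_def narayana_B_perm_mult_power)
qed

lemma sum_narayana_B_perm_factor:
  "(\<Sum>w \<in> sym_group n. fps_of_poly (narayana_B_perm n w) * eulerian_factor t (num_cycles n w)) =
    fact n * nar_ratio_diff fps_X t n"
proof -
  have "fps_of_poly (narayana_B_perm n w) * eulerian_factor t (num_cycles n w) =
      fps_of_poly (narayana_B_perm n w) * ((1 - fps_X) * of_nat (Suc t)) ^ num_cycles n w -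
      fps_of_poly (narayana_B_perm n w) * ((1 - fps_X) * of_nat t) ^ num_cycles n w" for w
    unfolding eulerian_factor_def power_mult_distrib by (simp only: right_diff_distrib)
  then show ?thesis
    by (simp only: sum_subtractf sum_narayana_B_perm_power nar_ratio_diff_def right_diff_distrib)
qed

lemma num_cycles_pos:
  assumes "n \<ge> 1"
  shows "num_cycles n w \<ge> 1"
proof -
  have "perm_cycles n w \<noteq> {}" "finite (perm_cycles n w)"
    using assms by (auto simp: perm_cycles_def)
  then show ?thesis
    by (simp add: num_cycles_def cycle_type_def Suc_le_eq card_gt_0_iff)
qed

theorem corollary5p8:
  fixes n k :: nat
  assumes "n \<ge> 1" and "k \<ge> 1"
  shows "narayana_poly (n + k - 1) =
    smult (1 / (fact n * fact k))
      (\<Sum>\<pi> \<in> sym_group n. \<Sum>\<sigma> \<in> sym_group k.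
        narayana_B_perm n \<pi> * narayana_B_perm k \<sigma> *
        eulerian_E_poly (num_cycles n \<pi>) (num_cycles k \<sigma>))"
proof -
  define P where "P = (\<Sum>\<pi> \<in> sym_group n. \<Sum>\<sigma> \<in> sym_group k.
        narayana_B_perm n \<pi> * narayana_B_perm k \<sigma> *
        eulerian_E_poly (num_cycles n \<pi>) (num_cycles k \<sigma>))"
  let ?B = "\<lambda>n w. fps_of_poly (narayana_B_perm n w)"
  let ?E = "\<lambda>\<pi> \<sigma>. fps_of_poly (eulerian_E_poly (num_cycles n \<pi>) (num_cycles k \<sigma>))"
  let ?e = "\<lambda>t n w. eulerian_factor t (num_cycles n w)"
  let ?c = "fact n * fact k :: rat fps"
  \<comment> \<open>The factor \<open>1 - fps_X\<close> is common to both truncated expansions.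
    Congruence modulo \<open>fps_X ^ Suc i\<close> settles the coefficient at
    \<open>i\<close>.\<close>
  have "(1 - fps_X) * (fps_of_poly P - ?c * nar_coeff fps_X (n + k - 1)) = 0"
  proof (rule fps_ext)
    fix i
    define T where "T = Suc i"
    have "(\<Sum>t<T. fps_X ^ t * ((fact n * nar_ratio_diff fps_X t n) * (fact k * nar_ratio_diff fps_X t k))) =
        (\<Sum>t<T. \<Sum>\<pi> \<in> sym_group n. \<Sum>\<sigma> \<in> sym_group k. ?B n \<pi> * ?B k \<sigma> * (fps_X ^ t * (?e t n \<pi> * ?e t k \<sigma>)))"
      unfolding sum_narayana_B_perm_factor[symmetric] sum_product
      unfolding sum_distrib_left by (intro sum.cong refl) (simp only: mult_ac)
    also have "\<dots> = (\<Sum>\<pi> \<in> sym_group n. \<Sum>\<sigma> \<in> sym_group k. ?B n \<pi> * ?B k \<sigma> *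
        (\<Sum>t<T. fps_X ^ t * (?e t n \<pi> * ?e t k \<sigma>)))"
      \<comment> \<open>Truncation keeps the sum over \<open>t\<close> finite, so it can be moved
        inside the sums over permutations.\<close>
      unfolding sum_distrib_left by (subst sum.swap, intro sum.cong refl, subst sum.swap, rule refl)
    finally have 1: "(\<Sum>\<pi> \<in> sym_group n. \<Sum>\<sigma> \<in> sym_group k. ?B n \<pi> * ?B k \<sigma> *
        (\<Sum>t<T. fps_X ^ t * (?e t n \<pi> * ?e t k \<sigma>))) =
        ?c * (\<Sum>t<T. fps_X ^ t * (nar_ratio_diff fps_X t n * nar_ratio_diff fps_X t k))"
      unfolding sum_distrib_left[of ?c] by (simp only: mult_ac)
    have 2: "(1 - fps_X) * fps_of_poly P =
        (\<Sum>\<pi> \<in> sym_group n. \<Sum>\<sigma> \<in> sym_group k. ?B n \<pi> * ?B k \<sigma> * ((1 - fps_X) * ?E \<pi> \<sigma>))"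
      unfolding P_def fps_of_poly_sum fps_of_poly_mult sum_distrib_left
      by (intro sum.cong refl) (simp only: mult_ac)
    let ?S = "\<Sum>t<T. fps_X ^ t * (nar_ratio_diff fps_X t n * nar_ratio_diff fps_X t k)"
    \<comment> \<open>Up to the factor \<open>?c\<close>, both sides are congruent to the same
      truncation \<open>?S\<close>.\<close>
    have dvd1: "fps_X ^ T dvd (1 - fps_X) * fps_of_poly P - ?c * ?S"
      unfolding 1[symmetric] 2 sum_subtractf[symmetric] right_diff_distrib[symmetric]
      by (intro dvd_sum dvd_mult eulerian_E_poly_truncated num_cycles_pos assms)
    have dvd2: "fps_X ^ T dvd ?c * ((1 - fps_X) * nar_coeff fps_X (n + k - 1) - ?S)"
      using assms by (intro dvd_mult nar_coeff_truncated) auto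
    have "(1 - fps_X) * (fps_of_poly P - ?c * nar_coeff fps_X (n + k - 1)) =
        ((1 - fps_X) * fps_of_poly P - ?c * ?S) - ?c * ((1 - fps_X) * nar_coeff fps_X (n + k - 1) - ?S)"
      by (simp only: right_diff_distrib mult_ac) simp
    then have "fps_X ^ T dvd (1 - fps_X) * (fps_of_poly P - ?c * nar_coeff fps_X (n + k - 1))"
      using dvd_diff[OF dvd1 dvd2] by (simp only:)
    then obtain r where
      "(1 - fps_X) * (fps_of_poly P - ?c * nar_coeff fps_X (n + k - 1)) = fps_X ^ T * r"
      by (elim dvdE)
    then show "((1 - fps_X) * (fps_of_poly P - ?c * nar_coeff fps_X (n + k - 1))) $ i = 0 $ i"
      by (simp only: fps_X_power_mult_nth) (simp add: T_def)
  qed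
  moreover have "1 - fps_X \<noteq> (0 :: rat fps)"
    by (metis eq_iff_diff_eq_0 fps_X_neq_one)
  ultimately have "fps_of_poly P = ?c * fps_of_poly (narayana_poly (n + k - 1))"
    using assms by (simp add: fps_of_poly_narayana_poly)
  also have "?c = fps_of_poly [:fact n * fact k:]"
  proof -
    have "(fact m :: rat fps) = fps_const (fact m)" for m
      using fps_of_nat[of "fact m", where 'a=rat] unfolding of_nat_fact by (rule sym)
    then show ?thesis by (simp only: fps_of_poly_const fps_const_mult)
  qed
  finally have "P = smult (fact n * fact k) (narayana_poly (n + k - 1))"
    by (simp only: fps_of_poly_mult[symmetric] fps_of_poly_eq_iff) simp
  then show ?thesis
    unfolding P_def[symmetric] by simp
qed

end
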